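(* Let $c$ be a prefix equivalent statistic and $\theta>0$. For any type II prefixes $\sigma$ and $\tau$ with $|\sigma|=|\tau|-1=k-1$ (where $2\le k\le N$... with $\sigma,\tau$ of lengths $k-1$ and $k$), if $\tau$ is negative then $\sigma$ is negative.
   Context: Fix $N\ge1$ and $\theta>0$. A prefix is an element of $\bigcup_{k=1}^N S_k$; $|\sigma|$ is its length. For $\pi\in S_N$ and $k\le N$, $\pi|_k\in S_k$ is the permutation order-isomorphic to $(\pi_1,\dots,\pi_k)$. $\pi$ is $\sigma$-prefixed if $\pi|_{|\sigma|}=\sigma$, and $\sigma$-winnable if moreover $\pi_{|\sigma|}=N-1$. A prefix $\sigma$ of length $k$ is of type I if $\sigma_k=k$ and of type II if $\sigma_k=k-1$. For $\tau\in S_k$ and a prefix $\rho$ of length $m\ge k$ with $\rho|_k=[12\cdots k]$, let $g_\tau\cdot\rho=(\rho_{\tau_1},\dots,\rho_{\tau_k},\rho_{k+1},\dots,\rho_m)$ (the first $k$ entries rearranged to have relative order $\tau$, the rest fixed). A statistic $c:\bigcup_{i=1}^N S_i\to\mathbb{Z}_{\ge0}$ is prefix equivalent if $c(\rho)-c(g_\tau\cdot\rho)=c([12\cdots k])-c(\tau)$ for all $k$, all $\tau\in S_k$ and all such $\rho$ (e.g. the number of inversions). The interview order $\pi\in S_N$ is random with $P(\pi)\propto\theta^{c(\pi)}$; at time $i$ a strategy sees only $\pi|_i$ and accepts or rejects irrevocably, and wins if the accepted candidate has value $N-1$. For a prefix $\sigma$: $Q(\sigma)=\sum_{\sigma\text{-winnable}\,\pi}\theta^{c(\pi)}/\sum_{\sigma\text{-prefixed}\,\pi}\theta^{c(\pi)}$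 (conditional probability of winning by accepting at time $|\sigma|$ given $\pi$ is $\sigma$-prefixed); $Q^o(\sigma)$ is the maximal conditional probability, given $\pi$ is $\sigma$-prefixed, of winning with a strategy that rejects candidate $|\sigma|$ and all earlier ones ($Q^o(\sigma)=0$ if $|\sigma|=N$). $\sigma$ is positive if $Q(\sigma)\ge Q^o(\sigma)$ and negative otherwise. *)

theory Defs
  imports "HOL-Probability.Probability" "HOL-Combinatorics.Multiset_Permutations"
begin

text \<open>Permutations of \<open>{1..k}\<close> are lists in one-line notation, so the entry written
  \<open>\<pi>\<^sub>i\<close> (counted from 1) is \<open>\<pi> ! (i - 1)\<close>.\<close>

abbreviation Sym :: "nat \<Rightarrow> nat list set" where
  "Sym k \<equiv> permutations_of_set {1..k}"

definition perm_prefixes :: "nat \<Rightarrow> nat list set" where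
  "perm_prefixes N = (\<Union>k\<in>{1..N}. Sym k)"

text \<open>The permutation order-isomorphic to a list of distinct numbers: every entry is replaced by
  its rank.\<close>

definition standardize :: "nat list \<Rightarrow> nat list" where
  "standardize xs = map (\<lambda>x. card {y \<in> set xs. y \<le> x}) xs"

definition restr :: "nat list \<Rightarrow> nat \<Rightarrow> nat list" where
  "restr \<pi> k = standardize (take k \<pi>)"

definition prefixed :: "nat list \<Rightarrow> nat list \<Rightarrow> bool" where
  "prefixed \<sigma> \<pi> \<longleftrightarrow> restr \<pi> (length \<sigma>) = \<sigma>"

definition winnable :: "nat \<Rightarrow> nat list \<Rightarrow> nat list \<Rightarrow> bool" where
  "winnable N \<sigma> \<pi> \<longleftrightarrow> prefixed \<sigma> \<pi> \<and> \<pi> ! (length \<sigma> - 1) = N - 1"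

definition type_II :: "nat list \<Rightarrow> bool" where
  "type_II \<sigma> \<longleftrightarrow> \<sigma> ! (length \<sigma> - 1) = length \<sigma> - 1"

text \<open>The action \<open>g\<^sub>\<tau> \<cdot> \<rho>\<close>, for \<open>\<rho>\<close> whose first \<open>length \<tau>\<close> entries are increasing.\<close>

definition prefix_action :: "nat list \<Rightarrow> nat list \<Rightarrow> nat list" where
  "prefix_action \<tau> \<rho> = map (\<lambda>i. \<rho> ! (i - 1)) \<tau> @ drop (length \<tau>) \<rho>"

text \<open>Statistics are total functions on lists; only their values on
  \<^term>\<open>perm_prefixes N\<close> matter.\<close>

definition prefix_equivalent :: "nat \<Rightarrow> (nat list \<Rightarrow> nat) \<Rightarrow> bool" where
  "prefix_equivalent N c \<longleftrightarrow>
     (\<forall>k\<in>{1..N}. \<forall>\<tau>\<in>Sym k. \<forall>\<rho>\<in>perm_prefixes N.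
        k \<le> length \<rho> \<and> restr \<rho> k = [1..<Suc k] \<longrightarrow>
        int (c \<rho>) - int (c (prefix_action \<tau> \<rho>)) = int (c [1..<Suc k]) - int (c \<tau>))"

definition interview_pmf :: "nat \<Rightarrow> real \<Rightarrow> (nat list \<Rightarrow> nat) \<Rightarrow> nat list pmf" where
  "interview_pmf N \<theta> c =
     embed_pmf (\<lambda>\<pi>. if \<pi> \<in> Sym N then \<theta> ^ c \<pi> / (\<Sum>\<rho>\<in>Sym N. \<theta> ^ c \<rho>) else 0)"

definition Q :: "nat \<Rightarrow> real \<Rightarrow> (nat list \<Rightarrow> nat) \<Rightarrow> nat list \<Rightarrow> real" where
  "Q N \<theta> c \<sigma> = (\<Sum>\<pi>\<in>{\<pi>\<in>Sym N. winnable N \<sigma> \<pi>}. \<theta> ^ c \<pi>) / (\<Sum>\<pi>\<in>{\<pi>\<in>Sym N. prefixed \<sigma> \<pi>}. \<theta> ^ c \<pi>)"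

text \<open>A strategy is the predicate deciding, from the relative order \<open>restr \<pi> i\<close> of the first
  \<open>i\<close> candidates, whether candidate \<open>i\<close> is accepted if no earlier one was. It loses if it
  accepts nobody.\<close>

type_synonym strategy = "nat list \<Rightarrow> bool"

definition accepts_at :: "strategy \<Rightarrow> nat list \<Rightarrow> nat \<Rightarrow> bool" where
  "accepts_at s \<pi> i \<longleftrightarrow> s (restr \<pi> i) \<and> (\<forall>j\<in>{1..<i}. \<not> s (restr \<pi> j))"

definition wins :: "nat \<Rightarrow> strategy \<Rightarrow> nat list \<Rightarrow> bool" where
  "wins N s \<pi> \<longleftrightarrow> (\<exists>i\<in>{1..N}. accepts_at s \<pi> i \<and> \<pi> ! (i - 1) = N - 1)"

definition rejects_through :: "nat list \<Rightarrow> strategy \<Rightarrow> bool" where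
  "rejects_through \<sigma> s \<longleftrightarrow> (\<forall>i\<in>{1..length \<sigma>}. \<not> s (restr \<sigma> i))"

definition Qo :: "nat \<Rightarrow> real \<Rightarrow> (nat list \<Rightarrow> nat) \<Rightarrow> nat list \<Rightarrow> real" where
  "Qo N \<theta> c \<sigma> =
     (if length \<sigma> = N then 0
      else Max {\<P>(\<pi> in measure_pmf (interview_pmf N \<theta> c). wins N s \<pi> \<bar> prefixed \<sigma> \<pi>) | s.
                  rejects_through \<sigma> s})"

definition positive :: "nat \<Rightarrow> real \<Rightarrow> (nat list \<Rightarrow> nat) \<Rightarrow> nat list \<Rightarrow> bool" where
  "positive N \<theta> c \<sigma> \<longleftrightarrow> Q N \<theta> c \<sigma> \<ge> Qo N \<theta> c \<sigma>"

definition negative :: "nat \<Rightarrow> real \<Rightarrow> (nat list \<Rightarrow> nat) \<Rightarrow> nat list \<Rightarrow> bool" where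
  "negative N \<theta> c \<sigma> \<longleftrightarrow> \<not> positive N \<theta> c \<sigma>"

lemma weight_sum_pos: "\<theta> > 0 \<Longrightarrow> (\<Sum>\<rho>\<in>Sym N. \<theta> ^ c \<rho>) > (0::real)"
  by (intro sum_pos) auto

text \<open>\<^const>\<open>embed_pmf\<close> and \<^const>\<open>Max\<close> are unspecified outside their intended domain;
  for \<open>\<theta> > 0\<close> they are used within it: the weights sum to 1, and the set of
  winning probabilities is finite and nonempty.\<close>

lemma pmf_interview:
  assumes "\<theta> > 0"
  shows "pmf (interview_pmf N \<theta> c) \<pi> =
    (if \<pi> \<in> Sym N then \<theta> ^ c \<pi> / (\<Sum>\<rho>\<in>Sym N. \<theta> ^ c \<rho>) else 0)"
  unfolding interview_pmf_def
proof (rule pmf_embed_pmf)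
  let ?Z = "\<Sum>\<rho>\<in>Sym N. \<theta> ^ c \<rho>"
  let ?f = "\<lambda>\<pi>. if \<pi> \<in> Sym N then \<theta> ^ c \<pi> / ?Z else 0"
  have Z: "?Z > 0"
    using assms by (rule weight_sum_pos)
  show "0 \<le> ?f x" for x
    using assms Z by (auto intro!: divide_nonneg_pos)
  have "(\<integral>\<^sup>+x. ennreal (?f x) \<partial>count_space UNIV) = (\<Sum>x\<in>Sym N. ennreal (?f x))"
    by (rule nn_integral_count_space') (auto simp: less_top)
  also have "\<dots> = ennreal (\<Sum>x\<in>Sym N. ?f x)"
    using assms Z by (intro sum_ennreal) (auto intro!: divide_nonneg_pos)
  also have "(\<Sum>x\<in>Sym N. ?f x) = 1"
    using Z by (simp add: sum_divide_distrib [symmetric])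
  finally show "(\<integral>\<^sup>+x. ennreal (?f x) \<partial>count_space UNIV) = 1"
    by simp
qed

lemma prob_interview:
  assumes "\<theta> > 0"
  shows "\<P>(\<pi> in measure_pmf (interview_pmf N \<theta> c). P \<pi>) =
    (\<Sum>\<pi>\<in>{\<pi>\<in>Sym N. P \<pi>}. \<theta> ^ c \<pi>) / (\<Sum>\<rho>\<in>Sym N. \<theta> ^ c \<rho>)"
proof -
  have sub: "set_pmf (interview_pmf N \<theta> c) \<subseteq> Sym N"
    by (auto simp: set_pmf_iff pmf_interview [OF assms] split: if_splits)
  have "measure (measure_pmf (interview_pmf N \<theta> c)) {\<pi>. P \<pi>} =
        measure (measure_pmf (interview_pmf N \<theta> c)) {\<pi>\<in>Sym N. P \<pi>}"
    using sub by (intro measure_pmf.finite_measure_eq_AE AE_pmfI) auto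
  also have "\<dots> = (\<Sum>\<pi>\<in>{\<pi>\<in>Sym N. P \<pi>}. pmf (interview_pmf N \<theta> c) \<pi>)"
    by (rule measure_measure_pmf_finite) simp
  also have "\<dots> = (\<Sum>\<pi>\<in>{\<pi>\<in>Sym N. P \<pi>}. \<theta> ^ c \<pi> / (\<Sum>\<rho>\<in>Sym N. \<theta> ^ c \<rho>))"
    by (intro sum.cong) (auto simp: pmf_interview [OF assms])
  finally show ?thesis
    by (simp add: sum_divide_distrib)
qed

lemma cond_prob_interview:
  assumes "\<theta> > 0"
  shows "\<P>(\<pi> in measure_pmf (interview_pmf N \<theta> c). A \<pi> \<bar> B \<pi>) =
    (\<Sum>\<pi>\<in>{\<pi>\<in>Sym N. A \<pi> \<and> B \<pi>}. \<theta> ^ c \<pi>) / (\<Sum>\<pi>\<in>{\<pi>\<in>Sym N. B \<pi>}. \<theta> ^ c \<pi>)"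
  unfolding cond_prob_def prob_interview [OF assms]
  using weight_sum_pos [OF assms, of c N] by simp

lemma Q_eq_cond_prob:
  assumes "\<theta> > 0"
  shows "Q N \<theta> c \<sigma> =
    \<P>(\<pi> in measure_pmf (interview_pmf N \<theta> c). \<pi> ! (length \<sigma> - 1) = N - 1 \<bar> prefixed \<sigma> \<pi>)"
  unfolding cond_prob_interview [OF assms] Q_def winnable_def
  by (simp add: conj_commute)

lemma Qo_candidates:
  fixes N c \<sigma>
  assumes "\<theta> > 0"
  defines "V \<equiv> {\<P>(\<pi> in measure_pmf (interview_pmf N \<theta> c). wins N s \<pi> \<bar> prefixed \<sigma> \<pi>) | s.
                  rejects_through \<sigma> s}"
  shows "finite V" and "V \<noteq> {}"
proof -
  let ?g = "\<lambda>A. (\<Sum>\<pi>\<in>A. \<theta> ^ c \<pi>) / (\<Sum>\<pi>\<in>{\<pi>\<in>Sym N. prefixed \<sigma> \<pi>}. \<theta> ^ c \<pi>)"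
  have "V \<subseteq> ?g ` Pow (Sym N)"
    unfolding V_def cond_prob_interview [OF assms(1)] by auto
  then show "finite V"
    by (rule finite_subset) simp
  have "rejects_through \<sigma> (\<lambda>_. False)"
    by (simp add: rejects_through_def)
  then show "V \<noteq> {}"
    unfolding V_def by blast
qed

end

theory Submission
  imports Defs
begin

text \<open>Reordering the first \<open>k\<close> entries multiplies the weight by a factor depending only on the old
  and the new relative order. Hence an event that is invariant under such reorderings has the same
  conditional probability given any prefix of length at most \<open>k\<close>. Let \<open>\<sigma>\<close> and \<open>\<tau>\<close> have
  lengths \<open>k - 1\<close> and \<open>k\<close>. Accepting at the end of a type II prefix wins iff both top values
  have already appeared, and this becomes more likely with time, so \<open>Q(\<sigma>) \<le> Q(\<tau>)\<close>. A strategy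
  that rejects all of \<open>\<tau>\<close> can be transported to one that rejects the first \<open>k\<close> candidates,
  whatever their order, with the same winning probability, so \<open>Q\<^sup>o(\<tau>) \<le> Q\<^sup>o(\<sigma>)\<close>.\<close>

section \<open>Ranks and standardization\<close>

definition rank_in :: "nat set \<Rightarrow> nat \<Rightarrow> nat" where
  "rank_in S x = card {y \<in> S. y \<le> x}"

lemma standardize_eq_map_rank: "standardize xs = map (rank_in (set xs)) xs"
  by (simp add: standardize_def rank_in_def)

lemma length_standardize [simp]: "length (standardize xs) = length xs"
  by (simp add: standardize_def)

lemma rank_in_less:
  assumes "finite S" "y \<in> S" "x < y"
  shows "rank_in S x < rank_in S y"
proof -
  have "y \<in> {z \<in> S. z \<le> y}" "y \<notin> {z \<in> S. z \<le> x}" "{z \<in> S. z \<le> x} \<subseteq> {z \<in> S. z \<le> y}"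
    using assms by auto
  then show ?thesis
    unfolding rank_in_def using assms(1) by (intro psubset_card_mono) auto
qed

lemma strict_mono_on_rank_in: "finite S \<Longrightarrow> strict_mono_on S (rank_in S)"
  by (auto intro!: strict_mono_onI rank_in_less)

text \<open>A strictly increasing \<open>f\<close> maps the elements up to \<open>x\<close>
  bijectively onto those up to \<open>f x\<close>. This makes \<open>standardize\<close> blind to
  order-preserving relabelling.\<close>

lemma rank_in_image:
  fixes f :: "nat \<Rightarrow> nat"
  assumes "strict_mono_on S f" "x \<in> S"
  shows "rank_in (f ` S) (f x) = rank_in S x"
proof -
  have "{y \<in> f ` S. y \<le> f x} = f ` {y \<in> S. y \<le> x}"
    using assms strict_mono_on_less_eq[OF assms(1)] by auto
  moreover have "inj_on f {y \<in> S. y \<le> x}"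
    using strict_mono_on_imp_inj_on[OF assms(1)] by (rule inj_on_subset) auto
  ultimately show ?thesis
    by (simp add: rank_in_def card_image)
qed

lemma standardize_map:
  assumes "strict_mono_on (set xs) f"
  shows "standardize (map f xs) = standardize xs"
  using rank_in_image[OF assms] by (simp add: standardize_eq_map_rank)

lemma standardize_Sym:
  assumes "xs \<in> Sym k"
  shows "standardize xs = xs"
proof -
  have S: "set xs = {1..k}"
    using assms by (auto simp: permutations_of_set_def)
  have "rank_in {1..k} x = x" if "x \<in> {1..k}" for x
  proof -
    have "{y \<in> {1..k}. y \<le> x} = {1..x}"
      using that by auto
    then show ?thesis
      by (simp add: rank_in_def)
  qed
  then show ?thesis
    using S by (auto simp: standardize_eq_map_rank intro!: map_idI)
qed

text \<open>Ranks are injective on the entries and lie between 1 and the length, so counting forces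
  them to fill the whole interval.\<close>

lemma standardize_in_Sym:
  assumes "distinct xs"
  shows "standardize xs \<in> Sym (length xs)"
proof -
  have inj: "inj_on (rank_in (set xs)) (set xs)"
    by (intro strict_mono_on_imp_inj_on strict_mono_on_rank_in) simp
  have "rank_in (set xs) x \<in> {1..length xs}" if "x \<in> set xs" for x
  proof -
    have "card {x} \<le> rank_in (set xs) x"
      unfolding rank_in_def using that by (intro card_mono) auto
    moreover have "rank_in (set xs) x \<le> card (set xs)"
      unfolding rank_in_def by (intro card_mono) auto
    ultimately show ?thesis
      using card_length[of xs] by simp
  qed
  then have "rank_in (set xs) ` set xs \<subseteq> {1..length xs}"
    by blast
  moreover have "card (rank_in (set xs) ` set xs) = card {1..length xs}"
    using inj assms by (simp add: card_image distinct_card)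
  ultimately have "rank_in (set xs) ` set xs = {1..length xs}"
    by (intro card_subset_eq) auto
  then show ?thesis
    using inj assms
    by (auto simp: standardize_eq_map_rank permutations_of_set_def distinct_map)
qed

lemma restr_in_Sym:
  assumes "distinct \<pi>" "k \<le> length \<pi>"
  shows "restr \<pi> k \<in> Sym k"
  using standardize_in_Sym[of "take k \<pi>"] assms by (simp add: restr_def)

text \<open>The first \<open>j\<close> entries of \<open>restr \<pi> k\<close> are an increasing
  relabelling of \<open>take j \<pi>\<close>.\<close>

lemma restr_restr:
  assumes "j \<le> k"
  shows "restr (restr \<pi> k) j = restr \<pi> j"
proof -
  let ?f = "rank_in (set (take k \<pi>))"
  have "strict_mono_on (set (take k \<pi>)) ?f"
    by (rule strict_mono_on_rank_in) simp
  then have "strict_mono_on (set (take j \<pi>)) ?f"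
    by (rule monotone_on_subset) (rule set_take_subset_set_take[OF assms])
  moreover have "take j (restr \<pi> k) = map ?f (take j \<pi>)"
    using assms by (simp add: restr_def standardize_eq_map_rank take_map min_def)
  ultimately show ?thesis
    by (simp add: restr_def standardize_map)
qed

lemma prefixed_restr:
  assumes "prefixed \<tau> \<pi>" "j \<le> length \<tau>"
  shows "restr \<tau> j = restr \<pi> j"
  using assms restr_restr unfolding prefixed_def by metis

text \<open>The elements up to the one at index \<open>j\<close> of the sorted list occupy exactly
  the indices 0 to \<open>j\<close>. Ranks count from 1, hence the shift.\<close>

lemma sort_nth_rank_in:
  assumes "distinct xs" "x \<in> set xs"
  shows "sort xs ! (rank_in (set xs) x - 1) = x"
proof -
  obtain j where j: "j < length xs" "x = sort xs ! j"
    using assms(2) by (metis in_set_conv_nth length_sort set_sort)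
  have sd: "sorted_wrt (<) (sort xs)"
    using assms(1) by (simp add: strict_sorted_iff)
  have "{y \<in> set xs. y \<le> x} = (!) (sort xs) ` {..j}"
  proof (intro equalityI subsetI)
    fix y assume y: "y \<in> {y \<in> set xs. y \<le> x}"
    then obtain i where i: "i < length xs" "y = sort xs ! i"
      by (metis (no_types, lifting) in_set_conv_nth length_sort mem_Collect_eq set_sort)
    have "i \<le> j"
    proof (rule ccontr)
      assume "\<not> i \<le> j"
      then have "x < y"
        using sorted_wrt_nth_less[OF sd] i j by simp
      then show False
        using y by simp
    qed
    then show "y \<in> (!) (sort xs) ` {..j}"
      using i by auto
  next
    fix y assume "y \<in> (!) (sort xs) ` {..j}"
    then obtain i where i: "i \<le> j" "y = sort xs ! i"
      by auto
    have "y \<le> x"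
      using i j by (auto intro!: sorted_nth_mono)
    moreover have "y \<in> set xs"
      using i j by (metis le_less_trans length_sort nth_mem set_sort)
    ultimately show "y \<in> {y \<in> set xs. y \<le> x}"
      by simp
  qed
  moreover have "inj_on ((!) (sort xs)) {..j}"
    using assms(1) j by (intro inj_on_nth) auto
  ultimately have "rank_in (set xs) x = Suc j"
    by (simp add: rank_in_def card_image)
  then show ?thesis
    using j by simp
qed

lemma map_sort_nth_standardize:
  assumes "distinct xs"
  shows "map (\<lambda>i. sort xs ! (i - 1)) (standardize xs) = xs"
  using sort_nth_rank_in[OF assms] by (simp add: standardize_eq_map_rank map_idI)

section \<open>Rearranging the first entries\<close>

definition sort_prefix :: "nat \<Rightarrow> nat list \<Rightarrow> nat list" where
  "sort_prefix k \<pi> = sort (take k \<pi>) @ drop k \<pi>"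

text \<open>The action is meant for increasing initial segments. Sorting first extends it to every
  permutation: the values of the initial segment stay and their relative order becomes
  \<open>\<tau>\<close>.\<close>

definition rearrange :: "nat list \<Rightarrow> nat list \<Rightarrow> nat list" where
  "rearrange \<tau> \<pi> = prefix_action \<tau> (sort_prefix (length \<tau>) \<pi>)"

lemma upt_in_Sym: "[1..<Suc k] \<in> Sym k"
  by (simp add: permutations_of_set_def atLeastLessThanSuc_atLeastAtMost del: upt_Suc)

lemma mset_Sym:
  assumes "\<pi> \<in> Sym k" "\<rho> \<in> Sym k"
  shows "mset \<pi> = mset \<rho>"
  using assms set_eq_iff_mset_eq_distinct[of \<pi> \<rho>] by (simp add: permutations_of_set_def)

lemma Sym_cong_mset:
  assumes "\<pi> \<in> Sym N" "mset \<rho> = mset \<pi>"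
  shows "\<rho> \<in> Sym N"
  using assms(1) mset_eq_setD[OF assms(2)] mset_eq_imp_distinct_iff[OF assms(2)]
  by (simp add: permutations_of_set_def)

lemma length_Sym: "\<tau> \<in> Sym k \<Longrightarrow> length \<tau> = k"
  by (simp add: length_finite_permutations_of_set)

section \<open>Imposing a fixed relative order on the first \<open>k\<close> entries\<close>

context
  fixes \<tau> :: "nat list" and k :: nat
  assumes \<tau>: "\<tau> \<in> Sym k"
begin

lemma rearrange_eq:
  assumes "k \<le> length \<pi>"
  shows "rearrange \<tau> \<pi> = map (\<lambda>i. sort (take k \<pi>) ! (i - 1)) \<tau> @ drop k \<pi>"
proof -
  have "i - 1 < k" if "i \<in> set \<tau>" for i
    using \<tau> that by (auto simp: permutations_of_set_def)
  then show ?thesis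
    using assms length_Sym[OF \<tau>]
    by (auto simp: rearrange_def sort_prefix_def prefix_action_def nth_append)
qed

lemma length_rearrange: "k \<le> length \<pi> \<Longrightarrow> length (rearrange \<tau> \<pi>) = length \<pi>"
  using length_Sym[OF \<tau>] by (simp add: rearrange_eq)

lemma drop_rearrange: "k \<le> length \<pi> \<Longrightarrow> drop k (rearrange \<tau> \<pi>) = drop k \<pi>"
  using length_Sym[OF \<tau>] by (simp add: rearrange_eq)

lemma take_rearrange:
  "k \<le> length \<pi> \<Longrightarrow> take k (rearrange \<tau> \<pi>) = map (\<lambda>i. sort (take k \<pi>) ! (i - 1)) \<tau>"
  using length_Sym[OF \<tau>] by (simp add: rearrange_eq)

lemma mset_take_rearrange:
  assumes "k \<le> length \<pi>"
  shows "mset (take k (rearrange \<tau> \<pi>)) = mset (take k \<pi>)"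
proof -
  let ?f = "\<lambda>i. sort (take k \<pi>) ! (i - 1)"
  have "mset \<tau> = mset [1..<Suc k]"
    by (rule mset_Sym[OF \<tau> upt_in_Sym])
  then have "mset (map ?f \<tau>) = mset (map ?f [1..<Suc k])"
    by (simp only: mset_map)
  moreover have "map ?f [1..<Suc k] = sort (take k \<pi>)"
    using assms by (intro nth_equalityI) (auto simp del: upt_Suc)
  ultimately show ?thesis
    by (simp only: take_rearrange[OF assms] mset_sort)
qed

lemma set_take_rearrange: "k \<le> length \<pi> \<Longrightarrow> set (take k (rearrange \<tau> \<pi>)) = set (take k \<pi>)"
  by (rule mset_eq_setD) (rule mset_take_rearrange)

lemma mset_rearrange: "k \<le> length \<pi> \<Longrightarrow> mset (rearrange \<tau> \<pi>) = mset \<pi>"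
  using mset_take_rearrange[of \<pi>] drop_rearrange[of \<pi>]
  by (metis append_take_drop_id mset_append)

lemma rearrange_in_Sym:
  assumes "\<pi> \<in> Sym N" "k \<le> N"
  shows "rearrange \<tau> \<pi> \<in> Sym N"
  using assms(2) length_Sym[OF assms(1)]
  by (intro Sym_cong_mset[OF assms(1)] mset_rearrange) simp

lemma rearrange_cong:
  assumes "set (take k \<pi>) = set (take k \<pi>')" "drop k \<pi> = drop k \<pi>'"
    "distinct \<pi>" "distinct \<pi>'" "k \<le> length \<pi>" "k \<le> length \<pi>'"
  shows "rearrange \<tau> \<pi> = rearrange \<tau> \<pi>'"
proof -
  have "sort (take k \<pi>) = sort (take k \<pi>')"
    using assms by (intro sorted_distinct_set_unique) auto
  then show ?thesis
    using assms by (simp add: rearrange_eq)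
qed

text \<open>The new initial segment is the image of \<open>\<tau>\<close> under the map from
  \<open>i\<close> to the \<open>i\<close>-th smallest value, which is strictly increasing.\<close>

lemma prefixed_rearrange:
  assumes "distinct \<pi>" "k \<le> length \<pi>"
  shows "prefixed \<tau> (rearrange \<tau> \<pi>)"
proof -
  have sd: "sorted_wrt (<) (sort (take k \<pi>))"
    using assms(1) by (simp add: strict_sorted_iff)
  have "set \<tau> = {1..k}"
    using \<tau> by (auto simp: permutations_of_set_def)
  then have "strict_mono_on (set \<tau>) (\<lambda>i. sort (take k \<pi>) ! (i - 1))"
    using assms(2) by (intro strict_mono_onI sorted_wrt_nth_less[OF sd]) auto
  then have "standardize (take k (rearrange \<tau> \<pi>)) = standardize \<tau>"
    using assms(2) by (simp add: take_rearrange standardize_map)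
  then show ?thesis
    by (simp add: prefixed_def restr_def length_Sym[OF \<tau>] standardize_Sym[OF \<tau>])
qed

lemma rearrange_prefixed:
  assumes "prefixed \<tau> \<pi>" "distinct \<pi>" "k \<le> length \<pi>"
  shows "rearrange \<tau> \<pi> = \<pi>"
proof -
  have "standardize (take k \<pi>) = \<tau>"
    using assms(1) by (simp add: prefixed_def restr_def length_Sym[OF \<tau>])
  then have "map (\<lambda>i. sort (take k \<pi>) ! (i - 1)) \<tau> = take k \<pi>"
    using map_sort_nth_standardize[of "take k \<pi>"] assms(2) by simp
  then show ?thesis
    using assms(3) by (simp add: rearrange_eq)
qed

lemma rearrange_map:
  assumes "strict_mono_on (set \<pi>) f" "k \<le> length \<pi>"
  shows "rearrange \<tau> (map f \<pi>) = map f (rearrange \<tau> \<pi>)"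
proof -
  have "mono_on (set (sort (take k \<pi>))) f"
    using strict_mono_on_imp_mono_on[OF assms(1)]
    by (rule monotone_on_subset) (auto dest: in_set_takeD)
  then have "sorted (map f (sort (take k \<pi>)))"
    by (rule sorted_map_mono[OF sorted_sort])
  then have "sort (take k (map f \<pi>)) = map f (sort (take k \<pi>))"
    by (intro properties_for_sort) (simp_all add: take_map)
  moreover have "i - 1 < k" if "i \<in> set \<tau>" for i
    using \<tau> that by (auto simp: permutations_of_set_def)
  ultimately show ?thesis
    using assms(2) by (simp add: rearrange_eq drop_map)
qed

text \<open>Rearranging keeps the set of the first \<open>i\<close> values, hence their ranks, and
  commutes with increasing maps. So what is seen at time \<open>i\<close> determines what would be
  seen after rearranging.\<close>

lemma restr_rearrange:
  assumes "k \<le> i" "i \<le> length \<pi>"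
  shows "restr (rearrange \<tau> \<pi>) i = rearrange \<tau> (restr \<pi> i)"
proof -
  let ?xs = "take i \<pi>"
  have "take i (rearrange \<tau> \<pi>) = rearrange \<tau> ?xs"
    using assms length_Sym[OF \<tau>] by (simp add: rearrange_eq drop_take min_def)
  then have "restr (rearrange \<tau> \<pi>) i = map (rank_in (set (rearrange \<tau> ?xs))) (rearrange \<tau> ?xs)"
    by (simp add: restr_def standardize_eq_map_rank)
  also have "set (rearrange \<tau> ?xs) = set ?xs"
    using assms by (intro mset_eq_setD mset_rearrange) simp
  also have "map (rank_in (set ?xs)) (rearrange \<tau> ?xs) = rearrange \<tau> (map (rank_in (set ?xs)) ?xs)"
    using assms by (intro rearrange_map[symmetric] strict_mono_on_rank_in) auto
  finally show ?thesis
    by (simp add: restr_def standardize_eq_map_rank)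
qed

end

text \<open>Sorting forgets the order imposed before. This gives both the inverse bijections between
  prefix classes and the invariance of transported winning events.\<close>

lemma rearrange_rearrange:
  assumes "\<sigma> \<in> Sym k" "\<tau> \<in> Sym k" "distinct \<pi>" "k \<le> length \<pi>"
  shows "rearrange \<sigma> (rearrange \<tau> \<pi>) = rearrange \<sigma> \<pi>"
  using assms mset_rearrange[OF assms(2,4)]
  by (intro rearrange_cong[OF assms(1)])
    (auto simp: set_take_rearrange drop_rearrange length_rearrange dest: mset_eq_imp_distinct_iff)

text \<open>Supplies the condition under which \<open>prefix_equivalent\<close> constrains the
  action.\<close>

lemma restr_sort_prefix:
  assumes "distinct \<pi>" "k \<le> length \<pi>"
  shows "restr (sort_prefix k \<pi>) k = [1..<Suc k]"
proof -
  let ?xs = "sort (take k \<pi>)"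
  have len: "length ?xs = k"
    using assms by simp
  have S: "standardize ?xs \<in> Sym k"
    using standardize_in_Sym[of ?xs] assms(1) len by simp
  have "mono_on (set ?xs) (rank_in (set ?xs))"
    by (intro strict_mono_on_imp_mono_on strict_mono_on_rank_in) simp
  then have "sorted (standardize ?xs)"
    unfolding standardize_eq_map_rank
    by (rule sorted_map_mono[OF sorted_sort])
  then have "standardize ?xs = [1..<Suc k]"
    using permutations_of_setD[OF S] permutations_of_setD[OF upt_in_Sym]
    by (intro sorted_distinct_set_unique sorted_upt) simp_all
  then show ?thesis
    using len by (simp add: restr_def sort_prefix_def del: upt_Suc)
qed

lemma sort_prefix_in_Sym:
  assumes "\<pi> \<in> Sym N"
  shows "sort_prefix k \<pi> \<in> Sym N"
proof -
  have "mset (sort_prefix k \<pi>) = mset \<pi>"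
    by (metis append_take_drop_id mset_append mset_sort sort_prefix_def)
  then show ?thesis
    by (rule Sym_cong_mset[OF assms])
qed

section \<open>Conditional probabilities\<close>

context
  fixes N :: nat and \<theta> :: real and c :: "nat list \<Rightarrow> nat"
  assumes \<theta>: "\<theta> > 0" and pe: "prefix_equivalent N c"
begin

text \<open>Both \<open>\<pi>\<close> and \<open>rearrange \<tau> \<pi>\<close> come from the same
  \<open>sort_prefix k \<pi>\<close>, by acting with \<open>\<sigma>\<close> and
  \<open>\<tau>\<close>. Subtracting the two instances of prefix equivalence removes the identity
  terms.\<close>

lemma statistic_rearrange:
  assumes "\<sigma> \<in> Sym k" "\<tau> \<in> Sym k" "1 \<le> k" "k \<le> N" "\<pi> \<in> Sym N" "prefixed \<sigma> \<pi>"
  shows "c (rearrange \<tau> \<pi>) + c \<sigma> = c \<pi> + c \<tau>"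
proof -
  let ?\<rho> = "sort_prefix k \<pi>"
  have \<pi>: "distinct \<pi>" "length \<pi> = N"
    using assms(5) length_Sym[OF assms(5)] by (auto simp: permutations_of_set_def)
  have \<rho>: "?\<rho> \<in> Sym N"
    by (rule sort_prefix_in_Sym) fact
  then have "?\<rho> \<in> perm_prefixes N" "k \<le> length ?\<rho>"
    using assms length_Sym[OF \<rho>] by (auto simp: perm_prefixes_def)
  then have *: "int (c ?\<rho>) - int (c (prefix_action \<mu> ?\<rho>)) = int (c [1..<Suc k]) - int (c \<mu>)"
    if "\<mu> \<in> Sym k" for \<mu>
    using pe[unfolded prefix_equivalent_def, rule_format, of k \<mu> ?\<rho>]
      that assms(3,4) restr_sort_prefix[of \<pi> k] \<pi> by (simp del: upt_Suc)
  have eq: "prefix_action \<tau> ?\<rho> = rearrange \<tau> \<pi>" "prefix_action \<sigma> ?\<rho> = \<pi>"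
    using rearrange_prefixed[OF assms(1,6)] \<pi> assms length_Sym[OF assms(1)] length_Sym[OF assms(2)]
    by (simp_all add: rearrange_def)
  then show ?thesis
    using *[OF assms(1)] *[OF assms(2)] unfolding eq by linarith
qed

section \<open>Unnormalized weights of events and their invariance\<close>

definition weight :: "(nat list \<Rightarrow> bool) \<Rightarrow> real" where
  "weight E = (\<Sum>\<pi>\<in>{\<pi>\<in>Sym N. E \<pi>}. \<theta> ^ c \<pi>)"

lemma weight_nonneg: "weight E \<ge> 0"
  unfolding weight_def using \<theta> by (intro sum_nonneg) simp

lemma weight_mono:
  assumes "\<And>\<pi>. \<pi> \<in> Sym N \<Longrightarrow> E \<pi> \<Longrightarrow> F \<pi>"
  shows "weight E \<le> weight F"
  unfolding weight_def using assms \<theta> by (intro sum_mono2) auto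

lemma weight_cong:
  assumes "\<And>\<pi>. \<pi> \<in> Sym N \<Longrightarrow> E \<pi> = F \<pi>"
  shows "weight E = weight F"
  unfolding weight_def using assms by (intro sum.cong) auto

lemma weight_prefixed_pos:
  assumes "\<sigma> \<in> Sym k" "k \<le> N"
  shows "weight (prefixed \<sigma>) > 0"
proof -
  let ?\<iota> = "[1..<Suc N]"
  have "prefixed \<sigma> (rearrange \<sigma> ?\<iota>)"
    by (rule prefixed_rearrange[OF assms(1)]) (use assms(2) in \<open>auto simp del: upt_Suc\<close>)
  then have "rearrange \<sigma> ?\<iota> \<in> {\<pi>\<in>Sym N. prefixed \<sigma> \<pi>}"
    using rearrange_in_Sym[OF assms(1) upt_in_Sym assms(2)] by simp
  then show ?thesis
    unfolding weight_def using \<theta> by (intro sum_pos) auto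
qed

text \<open>\<open>rearrange \<tau>\<close> and \<open>rearrange \<sigma>\<close> are inverse
  bijections between the two prefix classes and scale each weight by a constant. The
  cross-multiplied form avoids negative exponents.\<close>

lemma weight_rearrange:
  assumes "\<sigma> \<in> Sym k" "\<tau> \<in> Sym k" "1 \<le> k" "k \<le> N"
    and inv: "\<And>\<pi>. \<pi> \<in> Sym N \<Longrightarrow> E (rearrange \<tau> \<pi>) = E \<pi>"
  shows "weight (\<lambda>\<pi>. E \<pi> \<and> prefixed \<sigma> \<pi>) * \<theta> ^ c \<tau> = weight (\<lambda>\<pi>. E \<pi> \<and> prefixed \<tau> \<pi>) * \<theta> ^ c \<sigma>"
proof -
  have S: "distinct \<pi>" "k \<le> length \<pi>" if "\<pi> \<in> Sym N" for \<pi>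
    using that assms(4) length_Sym[OF that] by (auto simp: permutations_of_set_def)
  have R: "rearrange \<mu> \<pi> \<in> Sym N" if "\<mu> \<in> Sym k" "\<pi> \<in> Sym N" for \<mu> \<pi>
    using that assms(4) by (rule rearrange_in_Sym)
  have restore: "rearrange \<mu> (rearrange \<nu> \<pi>) = \<pi>"
    if "\<mu> \<in> Sym k" "\<nu> \<in> Sym k" "\<pi> \<in> Sym N" "prefixed \<mu> \<pi>" for \<mu> \<nu> \<pi>
    using that S by (simp add: rearrange_rearrange rearrange_prefixed)
  \<comment> \<open>Invariance is assumed for \<open>rearrange \<tau>\<close> only; it is applied to
    \<open>rearrange \<sigma> \<pi>\<close>, which \<open>rearrange \<tau>\<close> takes back to
    \<open>\<pi>\<close>.\<close>
  have "E (rearrange \<sigma> \<pi>)" if "\<pi> \<in> Sym N" "prefixed \<tau> \<pi>" "E \<pi>" for \<pi>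
    using inv[OF R[OF assms(1) that(1)]] restore[OF assms(2,1) that(1,2)] that(3) by simp
  then have "(\<Sum>\<pi>\<in>{\<pi>\<in>Sym N. E \<pi> \<and> prefixed \<sigma> \<pi>}. \<theta> ^ c \<pi> * \<theta> ^ c \<tau>) =
      (\<Sum>\<pi>\<in>{\<pi>\<in>Sym N. E \<pi> \<and> prefixed \<tau> \<pi>}. \<theta> ^ c \<pi> * \<theta> ^ c \<sigma>)"
    using assms S restore R[OF assms(1)] R[OF assms(2)] statistic_rearrange[OF assms(1-4)]
    by (intro sum.reindex_bij_witness[where i = "rearrange \<sigma>" and j = "rearrange \<tau>"])
      (auto simp: prefixed_rearrange simp flip: power_add)
  then show ?thesis
    by (simp add: weight_def sum_distrib_right)
qed

lemma weight_split:
  assumes "\<sigma> \<in> Sym j" "j \<le> k" "k \<le> N"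
  shows "weight (\<lambda>\<pi>. E \<pi> \<and> prefixed \<sigma> \<pi>) =
    (\<Sum>\<mu>\<in>{\<mu>\<in>Sym k. restr \<mu> j = \<sigma>}. weight (\<lambda>\<pi>. E \<pi> \<and> prefixed \<mu> \<pi>))"
proof -
  let ?A = "{\<pi>\<in>Sym N. E \<pi> \<and> prefixed \<sigma> \<pi>}" and ?B = "{\<mu>\<in>Sym k. restr \<mu> j = \<sigma>}"
  have "restr \<pi> k \<in> Sym k" if "\<pi> \<in> Sym N" for \<pi>
    using that assms(3) length_Sym[OF that]
    by (intro restr_in_Sym) (auto simp: permutations_of_set_def)
  then have "(\<lambda>\<pi>. restr \<pi> k) ` ?A \<subseteq> ?B"
    using restr_restr[OF assms(2)] length_Sym[OF assms(1)] by (auto simp: prefixed_def)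
  then have "weight (\<lambda>\<pi>. E \<pi> \<and> prefixed \<sigma> \<pi>) =
      (\<Sum>\<mu>\<in>?B. \<Sum>\<pi>\<in>{\<pi>\<in>?A. restr \<pi> k = \<mu>}. \<theta> ^ c \<pi>)"
    unfolding weight_def by (intro sum.group[symmetric]) auto
  also have "\<dots> = (\<Sum>\<mu>\<in>?B. weight (\<lambda>\<pi>. E \<pi> \<and> prefixed \<mu> \<pi>))"
  proof (rule sum.cong)
    fix \<mu> assume "\<mu> \<in> ?B"
    then have \<mu>: "restr \<mu> j = \<sigma>" "length \<mu> = k"
      using length_Sym by auto
    then have "restr \<pi> j = \<sigma>" if "restr \<pi> k = \<mu>" for \<pi>
      using that restr_restr[OF assms(2), of \<pi>] by simp
    then have "{\<pi>\<in>?A. restr \<pi> k = \<mu>} = {\<pi>\<in>Sym N. E \<pi> \<and> prefixed \<mu> \<pi>}"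
      using \<mu>(2) length_Sym[OF assms(1)] by (auto simp: prefixed_def)
    then show "(\<Sum>\<pi>\<in>{\<pi>\<in>?A. restr \<pi> k = \<mu>}. \<theta> ^ c \<pi>) = weight (\<lambda>\<pi>. E \<pi> \<and> prefixed \<mu> \<pi>)"
      by (simp add: weight_def)
  qed simp
  finally show ?thesis .
qed

text \<open>Split the \<open>\<sigma>\<close>-prefixed permutations by their relative order at time
  \<open>k\<close> and compare each class with that of \<open>\<tau>\<close>. The resulting factor
  is the same for all invariant events, so it cancels against the certain event.\<close>

lemma invariant_weight_prefixed:
  assumes "\<sigma> \<in> Sym j" "\<tau> \<in> Sym k" "1 \<le> k" "j \<le> k" "k \<le> N"
    and inv: "\<And>\<pi>. \<pi> \<in> Sym N \<Longrightarrow> E (rearrange \<tau> \<pi>) = E \<pi>"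
  shows "weight (\<lambda>\<pi>. E \<pi> \<and> prefixed \<sigma> \<pi>) / weight (prefixed \<sigma>) =
    weight (\<lambda>\<pi>. E \<pi> \<and> prefixed \<tau> \<pi>) / weight (prefixed \<tau>)"
proof -
  let ?B = "{\<mu>\<in>Sym k. restr \<mu> j = \<sigma>}" and ?s = "\<Sum>\<mu>\<in>{\<mu>\<in>Sym k. restr \<mu> j = \<sigma>}. \<theta> ^ c \<mu>"
  have pos: "weight (prefixed \<sigma>) > 0" "weight (prefixed \<tau>) > 0" "\<theta> ^ c \<tau> > 0"
    using assms weight_prefixed_pos \<theta> by auto
  have *: "weight (\<lambda>\<pi>. F \<pi> \<and> prefixed \<sigma> \<pi>) * \<theta> ^ c \<tau> = weight (\<lambda>\<pi>. F \<pi> \<and> prefixed \<tau> \<pi>) * ?s"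
    if F: "\<And>\<pi>. \<pi> \<in> Sym N \<Longrightarrow> F (rearrange \<tau> \<pi>) = F \<pi>" for F
    unfolding weight_split[OF assms(1,4,5)] sum_distrib_left sum_distrib_right
    by (intro sum.cong refl weight_rearrange[OF _ assms(2,3,5)]) (auto simp: F)
  have E: "weight (\<lambda>\<pi>. E \<pi> \<and> prefixed \<sigma> \<pi>) * \<theta> ^ c \<tau> = weight (\<lambda>\<pi>. E \<pi> \<and> prefixed \<tau> \<pi>) * ?s"
    by (rule *) (rule inv)
  have P: "weight (prefixed \<sigma>) * \<theta> ^ c \<tau> = weight (prefixed \<tau>) * ?s"
    using *[of "\<lambda>_. True"] by simp
  have "weight (\<lambda>\<pi>. E \<pi> \<and> prefixed \<sigma> \<pi>) * weight (prefixed \<tau>) * \<theta> ^ c \<tau> =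
      (weight (\<lambda>\<pi>. E \<pi> \<and> prefixed \<sigma> \<pi>) * \<theta> ^ c \<tau>) * weight (prefixed \<tau>)"
    by (simp only: mult_ac)
  also have "\<dots> = weight (\<lambda>\<pi>. E \<pi> \<and> prefixed \<tau> \<pi>) * (weight (prefixed \<tau>) * ?s)"
    unfolding E by (simp only: mult_ac)
  also have "\<dots> = weight (\<lambda>\<pi>. E \<pi> \<and> prefixed \<tau> \<pi>) * weight (prefixed \<sigma>) * \<theta> ^ c \<tau>"
    unfolding P[symmetric] by (simp only: mult_ac)
  finally show ?thesis
    using pos \<theta> by (auto simp: frac_eq_eq)
qed

lemma cond_prob_weight:
  "\<P>(\<pi> in measure_pmf (interview_pmf N \<theta> c). E \<pi> \<bar> prefixed \<sigma> \<pi>) =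
    weight (\<lambda>\<pi>. E \<pi> \<and> prefixed \<sigma> \<pi>) / weight (prefixed \<sigma>)"
  by (simp add: cond_prob_interview[OF \<theta>] weight_def)

section \<open>Type II prefixes\<close>

text \<open>At length 1 the type II condition would demand the entry 0, but entries start at
  1.\<close>

lemma type_II_length:
  assumes "\<sigma> \<in> Sym k" "type_II \<sigma>" "1 \<le> k"
  shows "2 \<le> k"
proof -
  have "\<sigma> ! (k - 1) \<in> set \<sigma>"
    using assms length_Sym[OF assms(1)] by (intro nth_mem) simp
  then have "\<sigma> ! (k - 1) \<ge> 1"
    using permutations_of_setD(1)[OF assms(1)] by simp
  then show ?thesis
    using assms(2) length_Sym[OF assms(1)] by (simp add: type_II_def)
qed

text \<open>The candidate at time \<open>k\<close> is second best so far, of rank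
  \<open>k - 1\<close>. If \<open>N\<close> were missing, \<open>N - 1\<close> would have rank
  \<open>k\<close>; if both top values are present, \<open>N - 1\<close> has rank
  \<open>k - 1\<close>, and ranks are injective.\<close>

lemma type_II_wins_iff:
  assumes "\<sigma> \<in> Sym k" "type_II \<sigma>" "1 \<le> k" "k \<le> N" "\<pi> \<in> Sym N" "prefixed \<sigma> \<pi>"
  shows "\<pi> ! (k - 1) = N - 1 \<longleftrightarrow> {N - 1, N} \<subseteq> set (take k \<pi>)"
proof -
  let ?S = "set (take k \<pi>)" and ?x = "\<pi> ! (k - 1)"
  have k: "2 \<le> k"
    using assms type_II_length by blast
  have \<pi>: "distinct \<pi>" "set \<pi> = {1..N}" "length \<pi> = N"
    using assms(5) length_Sym[OF assms(5)] by (auto simp: permutations_of_set_def)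
  have sub: "?S \<subseteq> {1..N}"
    using \<pi> set_take_subset by metis
  have cS: "card ?S = k"
    using \<pi> assms by (simp add: distinct_card)
  have x: "?x \<in> ?S"
    using assms \<pi> by (auto simp: in_set_conv_nth intro!: exI[of _ "k - 1"])
  have "restr \<pi> k = \<sigma>"
    using assms(6) by (simp add: prefixed_def length_Sym[OF assms(1)])
  then have "rank_in ?S ?x = \<sigma> ! (k - 1)"
    using assms \<pi> by (auto simp: restr_def standardize_eq_map_rank)
  then have r: "rank_in ?S ?x = k - 1"
    using assms(2) by (simp add: type_II_def length_Sym[OF assms(1)])
  have big: "rank_in ?S y = k" if "\<forall>z\<in>?S. z \<le> y" for y
    using that cS by (simp add: rank_in_def Collect_conj_eq Int_absorb2 subset_iff)
  show ?thesis
  proof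
    assume xN: "?x = N - 1"
    have "N \<in> ?S"
    proof (rule ccontr)
      assume "N \<notin> ?S"
      then have "\<forall>z\<in>?S. z \<le> ?x"
        using sub xN by (metis One_nat_def Suc_pred atLeastAtMost_iff le_SucE less_le_trans
            subsetD zero_less_one)
      then show False
        using big r k by fastforce
    qed
    then show "{N - 1, N} \<subseteq> ?S"
      using x xN by simp
  next
    assume S: "{N - 1, N} \<subseteq> ?S"
    have "{z \<in> ?S. z \<le> N - 1} = ?S - {N}"
      using sub S by fastforce
    then have "rank_in ?S (N - 1) = k - 1"
      using S cS by (simp add: rank_in_def)
    then show "?x = N - 1"
      using r x S strict_mono_on_imp_inj_on[OF strict_mono_on_rank_in[of ?S]]
      by (auto simp: inj_on_def)
  qed
qed

text \<open>The winning event now depends only on the set of the first \<open>k\<close> values, so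
  it is invariant under rearrangement and grows with \<open>k\<close>.\<close>

lemma Q_type_II:
  assumes "\<sigma> \<in> Sym k" "type_II \<sigma>" "1 \<le> k" "k \<le> N"
  shows "Q N \<theta> c \<sigma> =
    weight (\<lambda>\<pi>. {N - 1, N} \<subseteq> set (take k \<pi>) \<and> prefixed \<sigma> \<pi>) / weight (prefixed \<sigma>)"
  unfolding Q_eq_cond_prob[OF \<theta>] cond_prob_weight length_Sym[OF assms(1)]
  using type_II_wins_iff[OF assms] by (intro arg_cong2[where f = "(/)"] weight_cong) auto

lemma Q_mono:
  assumes "\<sigma> \<in> Sym (k - 1)" "\<tau> \<in> Sym k" "type_II \<sigma>" "type_II \<tau>" "2 \<le> k" "k \<le> N"
  shows "Q N \<theta> c \<sigma> \<le> Q N \<theta> c \<tau>"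
proof -
  let ?E = "\<lambda>k \<pi>. {N - 1, N} \<subseteq> set (take k \<pi>)"
  have "weight (\<lambda>\<pi>. ?E (k - 1) \<pi> \<and> prefixed \<sigma> \<pi>) \<le> weight (\<lambda>\<pi>. ?E k \<pi> \<and> prefixed \<sigma> \<pi>)"
    by (intro weight_mono) (meson diff_le_self set_take_subset_set_take subset_trans)
  then have "Q N \<theta> c \<sigma> \<le> weight (\<lambda>\<pi>. ?E k \<pi> \<and> prefixed \<sigma> \<pi>) / weight (prefixed \<sigma>)"
    using assms by (simp add: Q_type_II[of \<sigma> "k - 1"] divide_right_mono weight_nonneg)
  \<comment> \<open>Only after enlarging the event from time \<open>k - 1\<close> to
    \<open>k\<close> is the condition exchanged; \<open>\<tau>\<close> need not extend
    \<open>\<sigma>\<close>.\<close>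
  also have "\<dots> = weight (\<lambda>\<pi>. ?E k \<pi> \<and> prefixed \<tau> \<pi>) / weight (prefixed \<tau>)"
  proof (rule invariant_weight_prefixed[OF assms(1,2)])
    fix \<pi> assume "\<pi> \<in> Sym N"
    then show "?E k (rearrange \<tau> \<pi>) = ?E k \<pi>"
      using assms(6) length_Sym[of \<pi> N] by (simp add: set_take_rearrange[OF assms(2)])
  qed (use assms in simp_all)
  also have "\<dots> = Q N \<theta> c \<tau>"
    using assms by (simp add: Q_type_II[of \<tau> k])
  finally show ?thesis .
qed

section \<open>Transporting strategies\<close>

text \<open>Play \<open>s\<close> as if the first candidates had come in the order
  \<open>\<tau>\<close>. The strict inequality forces rejection of all of them, whatever their
  actual order.\<close>

definition transport :: "nat list \<Rightarrow> strategy \<Rightarrow> strategy" where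
  "transport \<tau> s \<alpha> \<longleftrightarrow> length \<tau> < length \<alpha> \<and> s (rearrange \<tau> \<alpha>)"

text \<open>Up to time \<open>k\<close> both sides reject: \<open>transport\<close> by length, and
  \<open>s\<close> because the rearranged permutation shows it restrictions of
  \<open>\<tau>\<close>. Later, \<open>restr\<close> commutes with rearranging.\<close>

lemma accepts_at_transport:
  assumes "\<tau> \<in> Sym k" "k \<le> N" "rejects_through \<tau> s" "\<pi> \<in> Sym N" "i \<in> {1..N}"
  shows "accepts_at (transport \<tau> s) \<pi> i \<longleftrightarrow> accepts_at s (rearrange \<tau> \<pi>) i"
proof -
  have \<pi>: "distinct \<pi>" "length \<pi> = N" and l: "length \<tau> = k"
    using assms length_Sym[OF assms(1)] length_Sym[OF assms(4)] by (auto simp: permutations_of_set_def)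
  have "transport \<tau> s (restr \<pi> j) \<longleftrightarrow> s (restr (rearrange \<tau> \<pi>) j)" if "j \<in> {1..N}" for j
  proof (cases "j \<le> k")
    case True
    have "prefixed \<tau> (rearrange \<tau> \<pi>)"
      using assms \<pi> by (intro prefixed_rearrange) auto
    then have "restr (rearrange \<tau> \<pi>) j = restr \<tau> j"
      using prefixed_restr True l by metis
    then have "\<not> s (restr (rearrange \<tau> \<pi>) j)"
      using assms(3) True that l by (simp add: rejects_through_def)
    moreover have "length (restr \<pi> j) \<le> k"
      using True by (simp add: restr_def)
    ultimately show ?thesis
      using l by (simp add: transport_def)
  next
    case False
    moreover have "length (restr \<pi> j) = j"
      using that \<pi> by (simp add: restr_def)
    ultimately show ?thesis
      using that \<pi> l assms(1) by (simp add: transport_def restr_rearrange)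
  qed
  then show ?thesis
    using assms(5) by (auto simp: accepts_at_def)
qed

lemma wins_transport:
  assumes "\<tau> \<in> Sym k" "k \<le> N" "rejects_through \<tau> s" "\<pi> \<in> Sym N"
  shows "wins N (transport \<tau> s) \<pi> \<longleftrightarrow> wins N s (rearrange \<tau> \<pi>)"
proof -
  have \<pi>: "distinct \<pi>" "length \<pi> = N" and l: "length \<tau> = k"
    using assms length_Sym[OF assms(1)] length_Sym[OF assms(4)] by (auto simp: permutations_of_set_def)
  have "rearrange \<tau> \<pi> ! (i - 1) = \<pi> ! (i - 1)"
    if i: "i \<in> {1..N}" and "accepts_at (transport \<tau> s) \<pi> i" for i
  proof -
    have "k < length (restr \<pi> i)"
      using that l by (simp add: accepts_at_def transport_def)
    \<comment> \<open>Acceptance comes after time \<open>k\<close>, so the 0-based index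
      \<open>i - 1\<close> lies in the part that rearranging leaves fixed.\<close>
    then have "k \<le> i - 1"
      by (auto simp: restr_def)
    then show ?thesis
      using drop_rearrange[OF assms(1), of \<pi>] length_rearrange[OF assms(1), of \<pi>] assms \<pi>
      by (metis le_add_diff_inverse nth_drop)
  qed
  then show ?thesis
    unfolding wins_def using accepts_at_transport[OF assms] by metis
qed

text \<open>Transport an optimal strategy for \<open>\<tau>\<close>. Given \<open>\<tau>\<close>,
  rearranging is the identity and nothing changes. The new winning event is invariant, so its
  probability given \<open>\<sigma>\<close> is the same, and since \<open>j \<le> k\<close> the
  strategy is admissible for \<open>\<sigma>\<close>.\<close>

lemma Qo_antimono:
  assumes "\<sigma> \<in> Sym j" "\<tau> \<in> Sym k" "1 \<le> k" "j \<le> k" "k < N"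
  shows "Qo N \<theta> c \<tau> \<le> Qo N \<theta> c \<sigma>"
proof -
  let ?p = "\<lambda>\<sigma> s. \<P>(\<pi> in measure_pmf (interview_pmf N \<theta> c). wins N s \<pi> \<bar> prefixed \<sigma> \<pi>)"
  have l: "length \<sigma> = j" "length \<tau> = k"
    using length_Sym[OF assms(1)] length_Sym[OF assms(2)] .
  have Qo: "Qo N \<theta> c \<mu> = Max {?p \<mu> s | s. rejects_through \<mu> s}" if "length \<mu> \<noteq> N" for \<mu>
    using that by (simp add: Qo_def)
  \<comment> \<open>The maximum is attained; \<open>k < N\<close> excludes the default value
    0.\<close>
  have "Qo N \<theta> c \<tau> \<in> {?p \<tau> s | s. rejects_through \<tau> s}"
    using Qo[of \<tau>] Max_in[OF Qo_candidates[OF \<theta>, of N c \<tau>]] l assms by simp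
  then obtain s where s: "rejects_through \<tau> s" "Qo N \<theta> c \<tau> = ?p \<tau> s"
    by blast
  let ?t = "transport \<tau> s"
  have S: "distinct \<pi>" "k \<le> length \<pi>" if "\<pi> \<in> Sym N" for \<pi>
    using that assms length_Sym[OF that] by (auto simp: permutations_of_set_def)
  have w: "wins N ?t \<pi> \<longleftrightarrow> wins N s (rearrange \<tau> \<pi>)" if "\<pi> \<in> Sym N" for \<pi>
    using wins_transport[OF assms(2) _ s(1) that] assms by simp
  have "?p \<tau> s = ?p \<tau> ?t"
    unfolding cond_prob_weight using w assms(2) S
    by (intro arg_cong2[where f = "(/)"] weight_cong) (auto simp: rearrange_prefixed)
  also have "\<dots> = ?p \<sigma> ?t"
    unfolding cond_prob_weight
  proof (rule invariant_weight_prefixed[symmetric, OF assms(1-4)])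
    fix \<pi> assume "\<pi> \<in> Sym N"
    then show "wins N ?t (rearrange \<tau> \<pi>) = wins N ?t \<pi>"
      using w S assms rearrange_in_Sym[OF assms(2)] by (simp add: rearrange_rearrange)
  qed (use assms in simp)
  also have "rejects_through \<sigma> ?t"
    using l assms by (simp add: rejects_through_def transport_def restr_def)
  then have "?p \<sigma> ?t \<le> Qo N \<theta> c \<sigma>"
    using Qo[of \<sigma>] Max_ge[OF Qo_candidates(1)[OF \<theta>, of N c \<sigma>], of "?p \<sigma> ?t"] l assms by auto
  finally show ?thesis
    using s(2) by simp
qed

end

section \<open>Combining the inequalities for \<open>Q\<close> and \<open>Qo\<close>\<close>

theorem theorem2:
  fixes N :: nat and \<theta> :: real and c :: "nat list \<Rightarrow> nat" and \<sigma> \<tau> :: "nat list"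
  assumes "N \<ge> 1" and "\<theta> > 0"
    and "prefix_equivalent N c"
    and "\<sigma> \<in> perm_prefixes N" and "\<tau> \<in> perm_prefixes N"
    and "type_II \<sigma>" and "type_II \<tau>"
    and "length \<sigma> = length \<tau> - 1"
    and "negative N \<theta> c \<tau>"
  shows "negative N \<theta> c \<sigma>"
proof -
  obtain k where k: "1 \<le> k" "k \<le> N" "\<tau> \<in> Sym k"
    using assms(5) by (auto simp: perm_prefixes_def)
  \<comment> \<open>As \<open>\<sigma>\<close> is nonempty, the subtraction in
    \<open>j = k - 1\<close> is not truncated and \<open>k\<close> is at least 2.\<close>
  obtain j where j: "1 \<le> j" "\<sigma> \<in> Sym j"
    using assms(4) by (auto simp: perm_prefixes_def)
  have jk: "j = k - 1" "length \<tau> = k"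
    using assms(8) length_Sym[OF j(2)] length_Sym[OF k(3)] by auto
  have neg: "Q N \<theta> c \<tau> < Qo N \<theta> c \<tau>"
    using assms(9) by (simp add: negative_def positive_def)
  \<comment> \<open>At full length \<open>Qo\<close> is 0 by convention, so nonnegativity of
    \<open>Q\<close> would make \<open>\<tau>\<close> positive.\<close>
  have "Q N \<theta> c \<tau> \<ge> 0"
    unfolding Q_def using assms(2) by (intro divide_nonneg_nonneg sum_nonneg) auto
  then have "k \<noteq> N"
    using neg jk by (auto simp: Qo_def)
  then have "Q N \<theta> c \<sigma> \<le> Q N \<theta> c \<tau>" "Qo N \<theta> c \<tau> \<le> Qo N \<theta> c \<sigma>"
    using Q_mono[OF assms(2,3), of \<sigma> k \<tau>] Qo_antimono[OF assms(2,3), of \<sigma> j \<tau> k] assms k j jk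
    by auto
  then show ?thesis
    using neg by (simp add: negative_def positive_def)
qed

end
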